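(* Let $N\in\mathbb{N}$ and suppose that for each $1\le i\le N$ there are a (non-empty) Polish space $(X_i,\tau_{X_i})$ and a continuous map $T_i:(X_i,\tau_{X_i})\to(X_i,\tau_{X_i})$ such that $X_i$ can be endowed with a Hausdorff topology $\tau_i$ satisfying: (I) $T_i$ is a continuous self-map of $(X_i,\tau_i)$; (II) $\tau_i\subset\tau_{X_i}$; (III* ) every point of $X_i$ has a neighbourhood basis for $\tau_{X_i}$ consisting of $\tau_i$-compact sets. Let $X=\prod_{i=1}^NX_i$ with the product topology $\tau_X$ of the topologies $\tau_{X_i}$, and let $T:X\to X$, $T(x_1,\dots,x_N)=(T_1x_1,\dots,T_Nx_N)$. Then $$\overline{\operatorname{FRec}(T)}^{\tau_X}=\prod_{i=1}^N\overline{\operatorname{RRec}(T_i)}^{\tau_{X_i}}.$$ In particular: (a) The following statements are equivalent: (i) $\operatorname{FRec}(T)\neq\varnothing$; (ii) $\operatorname{UFRec}(T)\neq\varnothing$; (iii) $\operatorname{RRec}(T)\neq\varnothing$; (iv) $\operatorname{RRec}(T_i)\neq\varnothing$ for every $1\le i\le N$. (b) The following statements are equivalent: (i) $T$ is frequently recurrent; (ii) $T$ is $\mathcal{U}$-frequently recurrent; (iii) $T$ is reiteratively recurrent; (iv) $T_i$ is reiteratively recurrent for every $1\le i\le N$.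
   Context: $\mathbb{N}_0=\{0,1,2,\dots\}$. For a continuous self-map $S$ of a Polish space $Z$, $N(x,A)=\{n\in\mathbb{N}_0: S^nx\in A\}$. For $A\subset\mathbb{N}_0$: $\underline{\operatorname{dens}}(A)=\liminf_{N\to\infty}\frac{\operatorname{card}(A\cap[0,N])}{N+1}$, $\overline{\operatorname{dens}}(A)=\limsup_{N\to\infty}\frac{\operatorname{card}(A\cap[0,N])}{N+1}$, $\overline{\operatorname{Bd}}(A)=\limsup_{N\to\infty}\left(\max_{m\ge0}\frac{\operatorname{card}(A\cap[m,m+N])}{N+1}\right)$. $\operatorname{FRec}(S)$ (resp. $\operatorname{UFRec}(S)$, $\operatorname{RRec}(S)$) is the set of points $x$ such that $\underline{\operatorname{dens}}(N(x,U))>0$ (resp. $\overline{\operatorname{dens}}(N(x,U))>0$, $\overline{\operatorname{Bd}}(N(x,U))>0$) for every neighbourhood $U$ of $x$ in the Polish topology. $S$ is frequently (resp. $\mathcal{U}$-frequently, reiteratively) recurrent if $\operatorname{FRec}(S)$ (resp. $\operatorname{UFRec}(S)$, $\operatorname{RRec}(S)$) is dense for the Polish topology. *)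

theory Defs
  imports "HOL-Analysis.Analysis"
begin

section \<open>Densities of sets of natural numbers\<close>

text \<open>The densities are \<^typ>\<open>ereal\<close>-valued because \<^const>\<open>Liminf\<close> and \<^const>\<open>Limsup\<close>
  require a complete lattice; their values always lie in the unit interval.\<close>

definition lower_dens :: "nat set \<Rightarrow> ereal" where
  "lower_dens A = liminf (\<lambda>N. ereal (real (card (A \<inter> {0..N})) / real (N + 1)))"

definition upper_dens :: "nat set \<Rightarrow> ereal" where
  "upper_dens A = limsup (\<lambda>N. ereal (real (card (A \<inter> {0..N})) / real (N + 1)))"

text \<open>The maximum over all \<open>m\<close> is a genuine one: for fixed \<open>N\<close> only finitely many values
  occur, see \<open>finite_range_window_ratio\<close>.\<close>

definition upper_Banach_dens :: "nat set \<Rightarrow> ereal" where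
  "upper_Banach_dens A =
     limsup (\<lambda>N. ereal (MAX m. real (card (A \<inter> {m..m+N})) / real (N + 1)))"

lemma finite_range_window_ratio:
  "finite (range (\<lambda>m::nat. real (card (A \<inter> {m..m+N})) / real (N + 1)))"
proof (rule finite_subset)
  have "card (A \<inter> {m..m+N}) \<le> N + 1" for m
    using card_mono[of "{m..m+N}" "A \<inter> {m..m+N}"] by simp
  then show "range (\<lambda>m::nat. real (card (A \<inter> {m..m+N})) / real (N + 1))
      \<subseteq> (\<lambda>k. real k / real (N + 1)) ` {..N + 1}"
    by auto
qed simp


section \<open>Recurrence\<close>

definition Polish_topology :: "'a topology \<Rightarrow> bool" where
  "Polish_topology X \<longleftrightarrow> completely_metrizable_space X \<and> separable_space X"

text \<open>Neighbourhoods need not be open.\<close>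

definition neighbourhood_of_in :: "'a topology \<Rightarrow> 'a \<Rightarrow> 'a set \<Rightarrow> bool" where
  "neighbourhood_of_in X x U \<longleftrightarrow>
     U \<subseteq> topspace X \<and> (\<exists>V. openin X V \<and> x \<in> V \<and> V \<subseteq> U)"

definition return_set :: "('a \<Rightarrow> 'a) \<Rightarrow> 'a \<Rightarrow> 'a set \<Rightarrow> nat set" where
  "return_set S x A = {n. (S ^^ n) x \<in> A}"

definition FRec :: "'a topology \<Rightarrow> ('a \<Rightarrow> 'a) \<Rightarrow> 'a set" where
  "FRec X S = {x \<in> topspace X.
     \<forall>U. neighbourhood_of_in X x U \<longrightarrow> lower_dens (return_set S x U) > 0}"

definition UFRec :: "'a topology \<Rightarrow> ('a \<Rightarrow> 'a) \<Rightarrow> 'a set" where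
  "UFRec X S = {x \<in> topspace X.
     \<forall>U. neighbourhood_of_in X x U \<longrightarrow> upper_dens (return_set S x U) > 0}"

definition RRec :: "'a topology \<Rightarrow> ('a \<Rightarrow> 'a) \<Rightarrow> 'a set" where
  "RRec X S = {x \<in> topspace X.
     \<forall>U. neighbourhood_of_in X x U \<longrightarrow> upper_Banach_dens (return_set S x U) > 0}"

definition frequently_recurrent :: "'a topology \<Rightarrow> ('a \<Rightarrow> 'a) \<Rightarrow> bool" where
  "frequently_recurrent X S \<longleftrightarrow> X closure_of (FRec X S) = topspace X"

definition U_frequently_recurrent :: "'a topology \<Rightarrow> ('a \<Rightarrow> 'a) \<Rightarrow> bool" where
  "U_frequently_recurrent X S \<longleftrightarrow> X closure_of (UFRec X S) = topspace X"

definition reiteratively_recurrent :: "'a topology \<Rightarrow> ('a \<Rightarrow> 'a) \<Rightarrow> bool" where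
  "reiteratively_recurrent X S \<longleftrightarrow> X closure_of (RRec X S) = topspace X"


section \<open>Finite products\<close>

text \<open>Points of the product are functions on \<open>{1..N}\<close> that are \<^const>\<open>undefined\<close> elsewhere,
  as in \<^const>\<open>product_topology\<close>; hence the restriction.\<close>

definition product_self_map :: "nat \<Rightarrow> (nat \<Rightarrow> 'a \<Rightarrow> 'a) \<Rightarrow> (nat \<Rightarrow> 'a) \<Rightarrow> (nat \<Rightarrow> 'a)" where
  "product_self_map N T x = (\<lambda>i\<in>{1..N}. T i (x i))"

end

theory Submission
  imports Defs
begin

text \<open>The sets \<open>FRec T \<subseteq> UFRec T \<subseteq> RRec T \<subseteq> \<Prod>\<^sub>i RRec T\<^sub>i\<close> increase for formal reasons: densities
  compare, and a visit of \<open>T\<close> to a cylinder is a visit of one coordinate. All claims follow once the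
  last set lies in the closure of the first (\<open>PiE_RRec_subset_closure_FRec\<close>): then the four closures
  agree, and the four sets are empty or non-empty together. So let \<open>x\<^sub>i \<in> RRec T\<^sub>i\<close> and let \<open>K\<^sub>i\<close> be a
  \<open>\<tau>\<^sub>i\<close>-compact neighbourhood of \<open>x\<^sub>i\<close>; a frequently recurrent point of \<open>T\<close> is wanted in \<open>K = \<Prod>\<^sub>i K\<^sub>i\<close>.
  
  The classical route takes a \<open>T\<close>-invariant measure with \<open>\<mu> K > 0\<close> and applies the ergodic theorem.
  Here countable additivity is avoided, and compactness of \<open>K\<close> replaces it.
  
  \<^item> The orbits of the \<open>x\<^sub>i\<close> return to \<open>K\<^sub>i\<close> with positive density along arbitrarily long windows
    \<open>W\<^sub>i\<close> of times. Averaging over the points with coordinates \<open>(T\<^sub>i ^^ a\<^sub>i) x\<^sub>i\<close>, for \<open>a\<close> in the box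
    \<open>\<Prod>\<^sub>i W\<^sub>i\<close> turns the densities into their product, even if the \<open>x\<^sub>i\<close> never return
    simultaneously. Boxes with long sides are almost invariant under the diagonal shift, so a limit of these
    averages is a finitely additive probability \<open>m\<close> on all subsets with \<open>m A \<le> m (T\<^sup>-\<^sup>1 A)\<close> and
    \<open>m K > 0\<close> (\<open>product_mean\<close>).
  
  \<^item> For such \<open>m\<close>, any set \<open>V\<close> and \<open>c \<ge> 0\<close>, the points of \<open>V\<close> whose average number of visits
    to \<open>V\<close> falls below \<open>c\<close> at some time up to \<open>M\<close> have mass at most \<open>c\<close>
    (\<open>maximal_inequality\<close>), because the bad stretches of an orbit can be tiled.
  
  \<^item> Separability and the neighbourhood bases of \<open>\<tau>\<^sub>i\<close>-compact sets give countably many \<open>\<tau>\<close>-compact sets \<open>Q\<^sub>k\<close> such that every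
    neighbourhood of \<open>y\<close> contains some \<open>Q\<^sub>k \<ni> y\<close>; it is enough that \<open>y \<in> Q\<^sub>k\<close> implies a positive
    lower density of visits to \<open>Q\<^sub>k\<close>. That condition is not closed in \<open>y\<close>. Choosing \<open>\<tau>\<close>-open
    \<open>W\<^sub>k \<supseteq> Q\<^sub>k\<close> whose mass is almost minimal, one replaces it by the closed conditions ``\<open>y \<notin> W\<^sub>k\<close>, or \<open>y\<close>
    spends a fraction at least \<open>c\<^sub>k\<close> of the time up to \<open>n\<close> in the closure of \<open>V\<close>'', for all \<open>n\<close> and all open
    \<open>V \<supseteq> Q\<^sub>k\<close>. By the maximal inequality finitely many of them fail on a set of mass less than
    \<open>m K\<close>, so compactness yields a point of \<open>K\<close> satisfying all; and the closures of the \<open>V\<close> shrink to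
    \<open>Q\<^sub>k\<close> (\<open>FRec_meets_compact\<close>).\<close>

section \<open>Counting visits; comparison of densities\<close>

definition visits :: "('a \<Rightarrow> 'a) \<Rightarrow> 'a set \<Rightarrow> nat \<Rightarrow> 'a \<Rightarrow> nat" where
  "visits S A n x = card {j. j < n \<and> (S ^^ j) x \<in> A}"

lemma visits_Suc: "visits S A (Suc n) x = visits S A n x + (if (S ^^ n) x \<in> A then 1 else 0)"
proof -
  have "{j. j < Suc n \<and> (S ^^ j) x \<in> A}
      = (if (S ^^ n) x \<in> A then insert n {j. j < n \<and> (S ^^ j) x \<in> A} else {j. j < n \<and> (S ^^ j) x \<in> A})"
    by (auto simp: less_Suc_eq)
  then show ?thesis by (simp add: visits_def)
qed

lemma visits_mono: "A \<subseteq> B \<Longrightarrow> visits S A n x \<le> visits S B n x"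
  unfolding visits_def by (rule card_mono) auto

lemma visits_shift:
  "visits S A n ((S ^^ j) x) = card (return_set S x A \<inter> {j..<j + n})"
proof -
  have shift: "(S ^^ i) ((S ^^ j) x) = (S ^^ (i + j)) x" for i
    by (simp add: funpow_add)
  have "return_set S x A \<inter> {j..<j + n} = (\<lambda>i. i + j) ` {i. i < n \<and> (S ^^ (i + j)) x \<in> A}"
  proof (intro equalityI subsetI)
    fix k assume "k \<in> return_set S x A \<inter> {j..<j + n}"
    then have "k = (k - j) + j" "k - j < n" "(S ^^ (k - j + j)) x \<in> A"
      by (auto simp: return_set_def)
    then show "k \<in> (\<lambda>i. i + j) ` {i. i < n \<and> (S ^^ (i + j)) x \<in> A}" by blast
  qed (auto simp: return_set_def)
  then show ?thesis
    by (simp add: visits_def card_image shift)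
qed

lemma lower_dens_le_upper_dens: "lower_dens A \<le> upper_dens A"
  unfolding lower_dens_def upper_dens_def by (rule Liminf_le_Limsup) simp

lemma upper_dens_le_upper_Banach_dens: "upper_dens A \<le> upper_Banach_dens A"
  unfolding upper_dens_def upper_Banach_dens_def
proof (intro Limsup_mono always_eventually allI)
  fix N
  have "real (card (A \<inter> {0..0 + N})) / real (N + 1)
      \<le> (MAX m. real (card (A \<inter> {m..m + N})) / real (N + 1))"
    by (intro Max_ge finite_range_window_ratio) blast
  then show "ereal (real (card (A \<inter> {0..N})) / real (N + 1))
      \<le> ereal (MAX m. real (card (A \<inter> {m..m + N})) / real (N + 1))"
    by simp
qed

text \<open>The limsup defining the upper Banach density gives long windows of density above a fixed \<open>d\<close>;
  only a lower bound on their lengths is needed, since the boxes built from them may have unequal sides.\<close>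
lemma dense_windows:
  assumes "upper_Banach_dens A > 0"
  obtains d where "d > 0"
    and "\<And>n. \<exists>s L. n \<le> L \<and> d * real L \<le> real (card (A \<inter> {s..<s + L}))"
proof -
  let ?r = "\<lambda>N. MAX m. real (card (A \<inter> {m..m + N})) / real (N + 1)"
  from assms obtain d where d: "0 < ereal d" "ereal d < upper_Banach_dens A"
    using ereal_dense2[of 0 "upper_Banach_dens A"] by blast
  have "\<exists>s L. n \<le> L \<and> d * real L \<le> real (card (A \<inter> {s..<s + L}))" for n
  proof -
    have "\<not> (\<forall>\<^sub>F N in sequentially. ereal (?r N) \<le> ereal d)"
    proof
      assume "\<forall>\<^sub>F N in sequentially. ereal (?r N) \<le> ereal d"
      then have "upper_Banach_dens A \<le> ereal d"
        unfolding upper_Banach_dens_def by (rule Limsup_bounded)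
      with d(2) show False by (simp only: leD)
    qed
    then obtain N where "N \<ge> n" "\<not> ereal (?r N) \<le> ereal d"
      unfolding eventually_sequentially by blast
    then have N: "N \<ge> n" "?r N > d"
      by (simp_all only: ereal_less_eq not_le)
    have "?r N \<in> range (\<lambda>m. real (card (A \<inter> {m..m + N})) / real (N + 1))"
      by (intro Max_in finite_range_window_ratio) simp
    then obtain s where "?r N = real (card (A \<inter> {s..s + N})) / real (N + 1)" by blast
    with N(2) have s: "d < real (card (A \<inter> {s..s + N})) / real (N + 1)" by (simp only:)
    moreover have "{s..s + N} = {s..<s + Suc N}" by auto
    ultimately have "d * real (Suc N) \<le> real (card (A \<inter> {s..<s + Suc N}))"
      by (simp add: pos_less_divide_eq del: of_nat_Suc)
    then show ?thesis using N(1) by (intro exI[of _ s] exI[of _ "Suc N"]) simp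
  qed
  then show thesis using that[of d] d(1) by simp
qed

text \<open>Frequent visits are produced in the form of a bound uniform over all times \<open>n \<ge> 1\<close>, because such a bound is an
  intersection of conditions on finitely many iterates each.\<close>
lemma lower_dens_pos:
  assumes "c > 0" and "\<And>n. n \<ge> 1 \<Longrightarrow> c * real n \<le> real (visits S A n x)"
  shows "lower_dens (return_set S x A) > 0"
proof -
  have "c \<le> real (card (return_set S x A \<inter> {0..N})) / real (N + 1)" for N
  proof -
    have "return_set S x A \<inter> {0..N} = {j. j < N + 1 \<and> (S ^^ j) x \<in> A}"
      by (auto simp: return_set_def)
    with assms(2)[of "N + 1"] show ?thesis
      by (simp add: visits_def pos_le_divide_eq)
  qed
  then have "ereal c \<le> lower_dens (return_set S x A)"
    unfolding lower_dens_def by (intro Liminf_bounded always_eventually) simp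
  moreover have "0 < ereal c" using \<open>c > 0\<close> by simp
  ultimately show ?thesis by (rule order.strict_trans2[rotated])
qed

section \<open>Finitely additive means and the maximal inequality\<close>

text \<open>The tiling argument behind the maximal inequality. Walk through the window from the left. At a
  point that is not a sparse start move one step, at no cost; at a sparse start jump over its
  sparse stretch of length \<open>n\<close>, which contains fewer than \<open>c * n\<close> elements of \<open>V\<close> and hence of the counted set.
  Only a last stretch that leaves the window is not paid for, and it costs at most \<open>M\<close>.\<close>
lemma card_sparse_starts:
  fixes c :: real and V :: "nat set"
  assumes "c \<ge> 0"
  shows "real (card {j \<in> V \<inter> {s..<s + L}.
           \<exists>n. 1 \<le> n \<and> n \<le> M \<and> real (card (V \<inter> {j..<j + n})) < c * real n})
         \<le> c * real L + real M"
proof (induction L arbitrary: s rule: less_induct)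
  case (less L)
  define B where "B = {j \<in> V. \<exists>n. 1 \<le> n \<and> n \<le> M \<and> real (card (V \<inter> {j..<j + n})) < c * real n}"
  have B_eq: "{j \<in> V \<inter> {s..<s + L}. \<exists>n. 1 \<le> n \<and> n \<le> M \<and> real (card (V \<inter> {j..<j + n})) < c * real n}
      = B \<inter> {s..<s + L}" for s L
    by (auto simp: B_def)
  have IH: "real (card (B \<inter> {s..<s + L'})) \<le> c * real L' + real M" if "L' < L" for s L'
    using less.IH[OF that, of s] unfolding B_eq .
  have "real (card (B \<inter> {s..<s + L})) \<le> c * real L + real M"
  proof (cases "L = 0")
    case True
    then show ?thesis by simp
  next
    case False
    consider "s \<notin> B"
      | n where "1 \<le> n" "n \<le> M" "real (card (V \<inter> {s..<s + n})) < c * real n"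
      by (auto simp: B_def)
    then show ?thesis
    proof cases
      case 1
      have "B \<inter> {s..<s + L} = B \<inter> {Suc s..<Suc s + (L - 1)}"
        using 1 False by (auto simp: Suc_le_eq le_less)
      then have "real (card (B \<inter> {s..<s + L})) \<le> c * real (L - 1) + real M"
        using IH[of "L - 1" "Suc s"] False by simp
      also have "\<dots> \<le> c * real L + real M"
        using assms by (simp add: mult_left_mono)
      finally show ?thesis .
    next
      case (2 n)
      show ?thesis
      proof (cases "n < L")
        case True
        have "B \<inter> {s..<s + L} \<subseteq> (V \<inter> {s..<s + n}) \<union> (B \<inter> {s + n..<s + n + (L - n)})"
          by (auto simp: B_def)
        then have "card (B \<inter> {s..<s + L})
            \<le> card ((V \<inter> {s..<s + n}) \<union> (B \<inter> {s + n..<s + n + (L - n)}))"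
          by (intro card_mono) auto
        also have "\<dots> \<le> card (V \<inter> {s..<s + n}) + card (B \<inter> {s + n..<s + n + (L - n)})"
          by (rule card_Un_le)
        finally have "real (card (B \<inter> {s..<s + L}))
            \<le> real (card (V \<inter> {s..<s + n})) + real (card (B \<inter> {s + n..<s + n + (L - n)}))"
          by linarith
        also have "\<dots> \<le> c * real n + (c * real (L - n) + real M)"
          using 2 True IH[of "L - n" "s + n"] by simp
        also have "\<dots> = c * real L + real M"
          using True by (simp add: of_nat_diff algebra_simps)
        finally show ?thesis .
      next
        case False
        have "card (B \<inter> {s..<s + L}) \<le> card {s..<s + L}"
          by (intro card_mono) auto
        then have "real (card (B \<inter> {s..<s + L})) \<le> real M"
          using False \<open>n \<le> M\<close> by simp
        also have "\<dots> \<le> c * real L + real M" using assms by simp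
        finally show ?thesis .
      qed
    qed
  qed
  then show ?case unfolding B_eq .
qed

text \<open>The mean is defined on all subsets, so no measurability enters. Invariance is kept as an
  inequality, the direction in which mass is transported in the maximal inequality; applied
  to complements it gives equality.\<close>
locale subinvariant_mean =
  fixes m :: "'a set \<Rightarrow> real" and T :: "'a \<Rightarrow> 'a"
  assumes nonneg: "0 \<le> m A"
    and additive: "A \<inter> B = {} \<Longrightarrow> m (A \<union> B) = m A + m B"
    and total: "m UNIV = 1"
    and subinvariant: "m A \<le> m (T -` A)"
begin

lemma empty [simp]: "m {} = 0"
  using additive[of "{}" "{}"] by simp

lemma diff: "A \<subseteq> B \<Longrightarrow> m (B - A) = m B - m A"
  using additive[of A "B - A"] by (simp add: Un_absorb1)

lemma mono: "A \<subseteq> B \<Longrightarrow> m A \<le> m B"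
  using diff[of A B] nonneg[of "B - A"] by simp

lemma subadditive: "m (A \<union> B) \<le> m A + m B"
  using additive[of A "B - A"] mono[of "B - A" B] by simp

lemma subadditive_finite: "finite I \<Longrightarrow> m (\<Union>i\<in>I. A i) \<le> (\<Sum>i\<in>I. m (A i))"
proof (induction I rule: finite_induct)
  case (insert i I)
  have "m (\<Union>i\<in>insert i I. A i) \<le> m (A i) + m (\<Union>i\<in>I. A i)"
    using subadditive[of "A i" "\<Union>i\<in>I. A i"] by simp
  with insert show ?case by simp
qed simp

lemma subinvariant_funpow: "m A \<le> m ((T ^^ j) -` A)"
proof (induction j)
  case (Suc j)
  note Suc
  also have "m ((T ^^ j) -` A) \<le> m (T -` ((T ^^ j) -` A))"
    by (rule subinvariant)
  also have "T -` ((T ^^ j) -` A) = (T ^^ Suc j) -` A"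
    unfolding funpow_Suc_right by (rule vimage_comp)
  finally show ?case .
qed simp

text \<open>This bounds the integral over \<open>E\<close> of the sum of the indicators of the \<open>A j\<close>, without integrals: the
  induction splits \<open>E\<close> along the last set, inside which the multiplicity of the others is at most \<open>R - 1\<close>. The restriction to an arbitrary \<open>E\<close> is what makes
  the induction go through.\<close>
lemma sum_le_multiplicity:
  assumes "\<And>x. x \<in> E \<Longrightarrow> real (card {j. j < (L::nat) \<and> x \<in> A j}) \<le> R"
  shows "(\<Sum>j<L. m (E \<inter> A j)) \<le> R * m E"
  using assms
proof (induction L arbitrary: E R)
  case 0
  then show ?case using nonneg[of E] by (cases "E = {}") (auto simp: not_less)
next
  case (Suc L)
  have card_Suc: "card {j. j < Suc L \<and> x \<in> A j}
      = (if x \<in> A L then Suc (card {j. j < L \<and> x \<in> A j}) else card {j. j < L \<and> x \<in> A j})" for x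
  proof -
    have "{j. j < Suc L \<and> x \<in> A j}
        = (if x \<in> A L then insert L {j. j < L \<and> x \<in> A j} else {j. j < L \<and> x \<in> A j})"
      by (auto simp: less_Suc_eq)
    then show ?thesis by simp
  qed
  have split: "m F = m (F \<inter> A L) + m (F - A L)" for F
    using additive[of "F \<inter> A L" "F - A L"] by (simp add: Int_Diff_Un Int_Diff_disjoint)
  have "(\<Sum>j<L. m ((E \<inter> A L) \<inter> A j)) \<le> (R - 1) * m (E \<inter> A L)"
  proof (rule Suc.IH)
    fix x assume "x \<in> E \<inter> A L"
    with Suc.prems[of x] show "real (card {j. j < L \<and> x \<in> A j}) \<le> R - 1"
      by (simp add: card_Suc)
  qed
  moreover have "(\<Sum>j<L. m ((E - A L) \<inter> A j)) \<le> R * m (E - A L)"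
  proof (rule Suc.IH)
    fix x assume "x \<in> E - A L"
    with Suc.prems[of x] show "real (card {j. j < L \<and> x \<in> A j}) \<le> R"
      by (simp add: card_Suc)
  qed
  moreover have "(\<Sum>j<L. m (E \<inter> A j))
      = (\<Sum>j<L. m ((E \<inter> A L) \<inter> A j)) + (\<Sum>j<L. m ((E - A L) \<inter> A j))"
    unfolding sum.distrib[symmetric]
  proof (rule sum.cong)
    fix j
    have "E \<inter> A j \<inter> A L = (E \<inter> A L) \<inter> A j" "E \<inter> A j - A L = (E - A L) \<inter> A j" by auto
    then show "m (E \<inter> A j) = m ((E \<inter> A L) \<inter> A j) + m ((E - A L) \<inter> A j)"
      using split[of "E \<inter> A j"] by simp
  qed simp
  ultimately show ?case
    using split[of E] by (simp add: algebra_simps)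
qed

text \<open>Up to time \<open>L\<close> each orbit meets the set at most \<open>c * L + M\<close> times by \<open>card_sparse_starts\<close>.
  Averaging with \<open>m\<close> bounds its mass by \<open>c + M / L\<close>, and \<open>L\<close> is arbitrary.\<close>
lemma maximal_inequality:
  assumes "c \<ge> 0"
  shows "m {x \<in> V. \<exists>n. 1 \<le> n \<and> n \<le> M \<and> real (visits T V n x) < c * real n} \<le> c"
    (is "m ?B \<le> c")
proof (rule ccontr)
  assume "\<not> m ?B \<le> c"
  then obtain L :: nat where L: "real L * (m ?B - c) > real M"
    using reals_Archimedean3[of "m ?B - c"] by auto
  have "real (card {j. j < L \<and> x \<in> (T ^^ j) -` ?B}) \<le> c * real L + real M" for x
  proof -
    have "{j. j < L \<and> x \<in> (T ^^ j) -` ?B}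
        = {j \<in> return_set T x V \<inter> {0..<0 + L}. \<exists>n. 1 \<le> n \<and> n \<le> M
             \<and> real (card (return_set T x V \<inter> {j..<j + n})) < c * real n}"
      by (auto simp: visits_shift return_set_def)
    then show ?thesis by (simp only: card_sparse_starts[OF assms])
  qed
  then have "(\<Sum>j<L. m (UNIV \<inter> (T ^^ j) -` ?B)) \<le> (c * real L + real M) * m UNIV"
    by (intro sum_le_multiplicity)
  moreover have "(\<Sum>j<L. m ?B) \<le> (\<Sum>j<L. m (UNIV \<inter> (T ^^ j) -` ?B))"
    using subinvariant_funpow[of ?B] by (intro sum_mono) (simp only: Int_UNIV_left)
  ultimately have "real L * m ?B \<le> c * real L + real M"
    by (simp add: total)
  with L show False by (simp add: algebra_simps)
qed

end

section \<open>Frequently recurrent points in compact sets of positive mass\<close>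

lemma continuous_map_funpow:
  assumes "continuous_map X X S"
  shows "continuous_map X X (S ^^ n)"
proof (induction n)
  case 0
  show ?case by (simp add: id_def)
next
  case (Suc n)
  then show ?case using assms unfolding funpow.simps by (rule continuous_map_compose)
qed

text \<open>Visits to a closed set are upper semicontinuous. This is why the conditions in
  \<open>FRec_meets_compact\<close> count visits to closures.\<close>
lemma closedin_visits_ge:
  assumes "continuous_map X X S" "closedin X C"
  shows "closedin X {x \<in> topspace X. c \<le> real (visits S C n x)}"
proof (induction n arbitrary: c)
  case 0
  then show ?case by (cases "c \<le> 0") (auto simp: visits_def)
next
  case (Suc n)
  have "{x \<in> topspace X. c \<le> real (visits S C (Suc n) x)}
      = {x \<in> topspace X. (S ^^ n) x \<in> C} \<inter> {x \<in> topspace X. c - 1 \<le> real (visits S C n x)}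
        \<union> {x \<in> topspace X. c \<le> real (visits S C n x)}"
    by (auto simp: visits_Suc split: if_splits)
  moreover have "closedin X {x \<in> topspace X. (S ^^ n) x \<in> C}"
    using closedin_continuous_map_preimage[OF continuous_map_funpow] assms by blast
  ultimately show ?case using Suc by (simp add: closedin_Int closedin_Un)
qed

text \<open>Closed neighbourhoods of a compact set in a Hausdorff space intersect in that set, and up to time \<open>n\<close> only
  finitely many points of the orbit have to be kept out; one \<open>V\<close> does this for all of them.\<close>
lemma visits_compact_ge:
  assumes X: "Hausdorff_space X" and Q: "compactin X Q"
    and orbit: "\<And>j. (S ^^ j) x \<in> topspace X"
    and V: "\<And>V. openin X V \<Longrightarrow> Q \<subseteq> V \<Longrightarrow> c \<le> real (visits S (X closure_of V) n x)"
  shows "c \<le> real (visits S Q n x)"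
proof -
  have "\<exists>V. openin X V \<and> Q \<subseteq> V \<and> z \<notin> X closure_of V" if "z \<in> topspace X" "z \<notin> Q" for z
  proof -
    obtain U V where UV: "openin X U" "openin X V" "{z} \<subseteq> U" "Q \<subseteq> V" "disjnt U V"
      using Hausdorff_space_compact_separation[OF X _ Q, of "{z}"] \<open>z \<in> topspace X\<close> \<open>z \<notin> Q\<close>
      by auto
    then have "z \<notin> X closure_of V" by (auto simp: in_closure_of disjnt_iff)
    with UV show ?thesis by blast
  qed
  then obtain W where W: "\<And>z. z \<in> topspace X \<Longrightarrow> z \<notin> Q \<Longrightarrow>
      openin X (W z) \<and> Q \<subseteq> W z \<and> z \<notin> X closure_of (W z)"
    by metis
  define J where "J = {j. j < n \<and> (S ^^ j) x \<notin> Q}"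
  define V where "V = (\<Inter>j\<in>J. W ((S ^^ j) x)) \<inter> topspace X"
  have "openin X V"
    unfolding V_def using W orbit by (intro openin_INT) (auto simp: J_def)
  moreover have "Q \<subseteq> V"
    using W orbit compactin_subset_topspace[OF Q] by (auto simp: V_def J_def)
  ultimately have "c \<le> real (visits S (X closure_of V) n x)" by (rule V)
  also have "visits S (X closure_of V) n x \<le> visits S Q n x"
    unfolding visits_def
  proof (rule card_mono)
    show "{j. j < n \<and> (S ^^ j) x \<in> X closure_of V} \<subseteq> {j. j < n \<and> (S ^^ j) x \<in> Q}"
    proof clarify
      fix j assume j: "j < n" "(S ^^ j) x \<in> X closure_of V"
      show "(S ^^ j) x \<in> Q"
      proof (rule ccontr)
        assume nQ: "(S ^^ j) x \<notin> Q"
        with j have "V \<subseteq> W ((S ^^ j) x)" by (auto simp: V_def J_def)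
        then have "X closure_of V \<subseteq> X closure_of (W ((S ^^ j) x))" by (rule closure_of_mono)
        with j W[OF orbit nQ] show False by blast
      qed
    qed
  qed simp
  finally show ?thesis by simp
qed

context subinvariant_mean
begin

text \<open>The infimum of \<open>m\<close> over the open supersets of \<open>A\<close> plays the part of an outer measure of \<open>A\<close>. A nearly
  minimal \<open>W\<close> leaves almost no mass between itself and any smaller open superset.\<close>
lemma near_minimal_open_superset:
  assumes "A \<subseteq> topspace X" "e > 0"
  shows "\<exists>W. openin X W \<and> A \<subseteq> W \<and> (\<forall>V. openin X V \<and> A \<subseteq> V \<longrightarrow> m W \<le> m V + e)"
proof -
  let ?M = "m ` {V. openin X V \<and> A \<subseteq> V}"
  have ne: "?M \<noteq> {}" using assms(1) openin_topspace by blast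
  have bdd: "bdd_below ?M" using nonneg by (intro bdd_belowI[of _ 0]) auto
  have "\<exists>a\<in>?M. a < Inf ?M + e"
    using cInf_lessD[OF ne, of "Inf ?M + e"] \<open>e > 0\<close> by auto
  then obtain W where W: "openin X W" "A \<subseteq> W" "m W < Inf ?M + e" by auto
  moreover have "m W \<le> m V + e" if "openin X V \<and> A \<subseteq> V" for V
    using cInf_lower[OF _ bdd, of "m V"] that W(3) by auto
  ultimately show ?thesis by blast
qed

text \<open>The topology \<open>X\<close> is the one in which \<open>K\<close> and the \<open>Q k\<close> are compact, whereas recurrence refers to
  \<open>Y\<close>; the two are linked only by the network \<open>Q\<close>.\<close>
lemma FRec_meets_compact:
  fixes Q :: "nat \<Rightarrow> 'a set"
  assumes X: "Hausdorff_space X" and T: "continuous_map X X T"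
    and Y: "topspace Y = topspace X"
    and Q: "\<And>k. compactin X (Q k)"
    and network: "\<And>U x. openin Y U \<Longrightarrow> x \<in> U \<Longrightarrow> \<exists>k. x \<in> Q k \<and> Q k \<subseteq> U"
    and K: "compactin X K" "m K > 0"
  shows "K \<inter> FRec Y T \<noteq> {}"
proof -
  \<comment> \<open>\<open>e k\<close> is both the tolerated excess mass of \<open>W k\<close> and the demanded frequency of visits to \<open>Q k\<close>; the total \<open>\<Sum>k. 2 * e k = m K / 2\<close> stays below \<open>m K\<close>.\<close>
  define e where "e k = m K / 4 * (1 / 2) ^ Suc k" for k :: nat
  have e_pos: "e k > 0" for k using K(2) by (simp add: e_def)
  have sum_e: "(\<Sum>k<n. 2 * e k) < m K" for n
  proof -
    have geom: "(\<Sum>k<n. (1 / 2 :: real) ^ k) = 2 * (1 - (1 / 2) ^ n)"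
      by (subst sum_gp_strict) simp
    have "(\<Sum>k<n. 2 * e k) = m K / 4 * (\<Sum>k<n. (1 / 2) ^ k)"
      unfolding sum_distrib_left by (intro sum.cong) (simp_all add: e_def)
    also have "\<dots> = m K / 2 * (1 - (1 / 2) ^ n)"
      unfolding geom by simp
    also have "\<dots> \<le> m K / 2 * 1"
      using K(2) by (intro mult_left_mono) simp_all
    also have "\<dots> < m K" using K(2) by simp
    finally show ?thesis .
  qed
  have "\<exists>W. \<forall>k. openin X (W k) \<and> Q k \<subseteq> W k
      \<and> (\<forall>V. openin X V \<and> Q k \<subseteq> V \<longrightarrow> m (W k) \<le> m V + e k)"
    by (intro choice allI near_minimal_open_superset compactin_subset_topspace Q e_pos)
  then obtain W where W: "\<And>k. openin X (W k)" "\<And>k. Q k \<subseteq> W k"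
    "\<And>k V. openin X V \<Longrightarrow> Q k \<subseteq> V \<Longrightarrow> m (W k) \<le> m V + e k"
    by blast
  define I where "I = {(k, n, V). openin X V \<and> Q k \<subseteq> V \<and> (1::nat) \<le> n}"
  \<comment> \<open>Requiring \<open>x \<notin> Q k\<close> in the first alternative would not give a closed set.\<close>
  define G where "G = (\<lambda>(k, n, V). {x \<in> topspace X. x \<notin> W k \<or>
      e k * real n \<le> real (visits T (X closure_of V) n x)})"
  have closed: "closedin X (G p)" for p
  proof -
    obtain k n V where p: "p = (k, n, V)" by (cases p)
    have "G p = (topspace X - W k) \<union>
        {x \<in> topspace X. e k * real n \<le> real (visits T (X closure_of V) n x)}"
      by (auto simp: G_def p)
    moreover have "closedin X (topspace X - W k)"
      using W(1)[of k] by (rule closedin_diff[OF closedin_topspace])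
    moreover have "closedin X {x \<in> topspace X. e k * real n \<le> real (visits T (X closure_of V) n x)}"
      by (rule closedin_visits_ge[OF T closedin_closure_of])
    ultimately show ?thesis by (simp only: closedin_Un)
  qed
  have fip: "K \<inter> \<Inter> (G ` J) \<noteq> {}" if J: "finite J" "J \<subseteq> I" for J
  proof -
    define M where "M = Max ((\<lambda>(k, n, V). max (Suc k) n) ` J)"
    have M: "k < M \<and> n \<le> M" if "(k, n, V) \<in> J" for k n V
    proof -
      have "(\<lambda>(k, n, V). max (Suc k) n) (k, n, V) \<le> M"
        unfolding M_def using J(1) that by (intro Max_ge finite_imageI imageI)
      then show ?thesis by simp
    qed
    \<comment> \<open>One open set serves all conditions of \<open>J\<close> with index \<open>k\<close>: visits to it are visits to every larger set.\<close>
    define V where "V k = (\<Inter>p\<in>{p \<in> J. fst p = k}. snd (snd p)) \<inter> topspace X \<inter> W k" for k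
    have V_open: "openin X (V k)" for k
    proof -
      have "openin X ((\<Inter>p\<in>{p \<in> J. fst p = k}. snd (snd p)) \<inter> topspace X)"
      proof (rule openin_INT)
        show "openin X (snd (snd p))" if "p \<in> {p \<in> J. fst p = k}" for p
          using that J(2) by (auto simp: I_def)
      qed (use J(1) in simp)
      from openin_Int[OF this W(1)] show ?thesis unfolding V_def .
    qed
    have Q_V: "Q k \<subseteq> V k" for k
    proof -
      have "Q k \<subseteq> snd (snd p)" if "p \<in> J" "fst p = k" for p
        using that J(2) by (cases p) (auto simp: I_def)
      then show ?thesis
        unfolding V_def using W(2) compactin_subset_topspace[OF Q[of k]] by blast
    qed
    define B where "B k = {x \<in> W k. \<exists>n. 1 \<le> n \<and> n \<le> M \<and> real (visits T (V k) n x) < e k * real n}" for k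
    have mB: "m (B k) \<le> 2 * e k" for k
    proof -
      let ?B = "{x \<in> V k. \<exists>n. 1 \<le> n \<and> n \<le> M \<and> real (visits T (V k) n x) < e k * real n}"
      have "m (B k) \<le> m ((W k - V k) \<union> ?B)"
        by (rule mono) (auto simp: B_def)
      also have "\<dots> \<le> m (W k - V k) + m ?B" by (rule subadditive)
      also have "m (W k - V k) = m (W k) - m (V k)"
        by (rule diff) (simp add: V_def)
      also have "m (W k) - m (V k) \<le> e k"
        using W(3)[OF V_open Q_V] by (simp add: algebra_simps)
      also have "m ?B \<le> e k"
        using e_pos by (intro maximal_inequality less_imp_le)
      finally show ?thesis by simp
    qed
    have "m (\<Union>k<M. B k) \<le> (\<Sum>k<M. m (B k))" by (rule subadditive_finite) simp
    also have "\<dots> \<le> (\<Sum>k<M. 2 * e k)" by (intro sum_mono mB)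
    also have "\<dots> < m K" by (rule sum_e)
    finally have "\<not> K \<subseteq> (\<Union>k<M. B k)" using mono[of K "\<Union>k<M. B k"] by linarith
    then obtain x where x: "x \<in> K" "\<And>k. k < M \<Longrightarrow> x \<notin> B k" by blast
    have "x \<in> G p" if "p \<in> J" for p
    proof -
      obtain k n V' where p: "p = (k, n, V')" by (cases p)
      have V': "openin X V'" "1 \<le> n" "k < M" "n \<le> M"
        using that J(2) M[of k n V'] by (auto simp: p I_def)
      have "V k \<subseteq> V'" using that by (auto simp: V_def p)
      also have "V' \<subseteq> X closure_of V'"
        using V'(1) by (intro closure_of_subset openin_subset)
      finally have "visits T (V k) n x \<le> visits T (X closure_of V') n x" by (rule visits_mono)
      moreover have "x \<in> topspace X" using x(1) K(1) compactin_subset_topspace by blast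
      moreover have "x \<notin> W k \<or> e k * real n \<le> real (visits T (V k) n x)"
        using x(2)[OF V'(3)] V'(2,4) unfolding B_def mem_Collect_eq not_less[symmetric] by blast
      ultimately show ?thesis by (auto simp: G_def p)
    qed
    with x(1) show ?thesis by blast
  qed
  have "K \<inter> \<Inter> (G ` I) \<noteq> {}"
  proof -
    have "K \<inter> \<Inter> \<F> \<noteq> {}" if F: "finite \<F>" "\<F> \<subseteq> G ` I" for \<F>
    proof -
      obtain J where "J \<subseteq> I" "finite J" "\<F> = G ` J"
        using finite_subset_image[OF F] by blast
      then show ?thesis using fip by blast
    qed
    moreover have "\<forall>C\<in>G ` I. closedin X C" using closed by blast
    ultimately show ?thesis using K(1) unfolding compactin_fip by blast
  qed
  then obtain y where y: "y \<in> K" "\<And>p. p \<in> I \<Longrightarrow> y \<in> G p" by blast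
  have y_top: "y \<in> topspace X" using y(1) K(1) compactin_subset_topspace by blast
  have orbit: "(T ^^ j) y \<in> topspace X" for j
    using continuous_map_funspace[OF continuous_map_funpow[OF T]] y_top by blast
  have "lower_dens (return_set T y U) > 0" if U: "neighbourhood_of_in Y y U" for U
  proof -
    obtain U' where U': "openin Y U'" "y \<in> U'" "U' \<subseteq> U"
      using U unfolding neighbourhood_of_in_def by blast
    obtain k where "y \<in> Q k" "Q k \<subseteq> U'" using network[OF U'(1,2)] by blast
    with U'(3) have k: "y \<in> Q k" "Q k \<subseteq> U" by simp_all
    show ?thesis
    proof (rule lower_dens_pos[OF e_pos[of k]])
      fix n :: nat assume n: "1 \<le> n"
      have "e k * real n \<le> real (visits T (Q k) n y)"
      proof (rule visits_compact_ge[OF X Q orbit])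
        fix V assume "openin X V" "Q k \<subseteq> V"
        with n have "(k, n, V) \<in> I" by (simp add: I_def)
        from y(2)[OF this] k(1) W(2)[of k] show "e k * real n \<le> real (visits T (X closure_of V) n y)"
          by (auto simp: G_def)
      qed
      also have "visits T (Q k) n y \<le> visits T U n y" using k(2) by (rule visits_mono)
      finally show "e k * real n \<le> real (visits T U n y)" by simp
    qed
  qed
  then show ?thesis using y(1) y_top Y by (auto simp: FRec_def)
qed

end

section \<open>Means as limits of averages over boxes of return times\<close>

text \<open>This replaces a Banach limit or an ultrafilter: by Tychonoff's theorem the sequence \<open>f\<close> has a cluster
  point in a power of the unit interval, and a filter \<open>G\<close> converging to it makes all coordinates converge.\<close>
lemma convergent_filter:
  fixes f :: "nat \<Rightarrow> 'i \<Rightarrow> real"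
  assumes "\<And>n i. f n i \<in> {0..1}"
  shows "\<exists>G. G \<noteq> bot \<and> G \<le> sequentially \<and> (\<forall>i. \<exists>l. ((\<lambda>n. f n i) \<longlongrightarrow> l) G)"
proof -
  have "compact (PiE UNIV (\<lambda>i::'i. {0..1::real}))"
    using compactin_PiE[of "\<lambda>_. euclidean" UNIV "\<lambda>i::'i. {0..1::real}"]
    by (simp add: euclidean_product_topology)
  moreover have "filtermap f sequentially \<noteq> bot"
    by (simp add: filtermap_bot_iff)
  moreover have "eventually (\<lambda>g. g \<in> PiE UNIV (\<lambda>i::'i. {0..1::real})) (filtermap f sequentially)"
    using assms by (simp add: eventually_filtermap PiE_UNIV_domain)
  ultimately obtain g where g: "inf (nhds g) (filtermap f sequentially) \<noteq> bot"
    unfolding compact_filter by blast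
  \<comment> \<open>\<open>G\<close> lives on the index set, so that limits along it are limits of the values \<open>f n i\<close>.\<close>
  define G where "G = inf (filtercomap f (nhds g)) sequentially"
  have lim: "filterlim f (nhds g) G"
    unfolding G_def using filterlim_filtercomap filterlim_mono inf_le1 by blast
  have "\<exists>l. ((\<lambda>n. f n i) \<longlongrightarrow> l) G" for i
  proof
    show "((\<lambda>n. f n i) \<longlongrightarrow> g i) G"
      using continuous_on_tendsto_compose[OF continuous_on_product_coordinates lim] by simp
  qed
  moreover have "G \<noteq> bot"
  proof
    assume "G = bot"
    then have "eventually (\<lambda>_. False) G" by simp
    then obtain P Q where PQ: "eventually P (filtercomap f (nhds g))" "eventually Q sequentially"
       "\<And>n. P n \<Longrightarrow> Q n \<Longrightarrow> False"
      unfolding G_def eventually_inf by blast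
    then obtain P' where P': "eventually P' (nhds g)" "\<And>n. P' (f n) \<Longrightarrow> P n"
      unfolding eventually_filtercomap by blast
    have "eventually (\<lambda>h. \<not> P' h) (filtermap f sequentially)"
      unfolding eventually_filtermap using PQ(2) by eventually_elim (use PQ(3) P'(2) in blast)
    with P'(1) have "eventually (\<lambda>_. False) (inf (nhds g) (filtermap f sequentially))"
      unfolding eventually_inf by blast
    with g show False by (simp add: eventually_False)
  qed
  moreover have "G \<le> sequentially" by (simp add: G_def)
  ultimately show ?thesis by blast
qed

text \<open>The indexing map \<open>\<phi>\<close> keeps multiplicities: distinct indices may give the same point, for instance on a
  periodic orbit.\<close>
lemma mean_of_almost_invariant_averages:
  fixes F :: "nat \<Rightarrow> 'b set" and \<phi> :: "'b \<Rightarrow> 'a"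
  assumes fin: "\<And>n. finite (F n)" and ne: "\<And>n. F n \<noteq> {}"
    and almost: "\<And>n A. real (card {b \<in> F n. \<phi> b \<in> A})
          \<le> real (card {b \<in> F n. T (\<phi> b) \<in> A}) + e n * real (card (F n))"
    and e: "e \<longlonglongrightarrow> 0"
    and dense: "\<And>n. d * real (card (F n)) \<le> real (card {b \<in> F n. \<phi> b \<in> K})"
  obtains m where "subinvariant_mean m T" "d \<le> m K"
proof -
  define f where "f n A = real (card {b \<in> F n. \<phi> b \<in> A}) / real (card (F n))" for n A
  have pos: "real (card (F n)) > 0" for n using fin ne by (simp add: card_gt_0_iff)
  have range: "f n A \<in> {0..1}" for n A
  proof -
    have "card {b \<in> F n. \<phi> b \<in> A} \<le> card (F n)" using fin by (intro card_mono) auto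
    then show ?thesis using pos[of n] by (simp add: f_def)
  qed
  obtain G where G: "G \<noteq> bot" "G \<le> sequentially" "\<And>A. \<exists>l. ((\<lambda>n. f n A) \<longlongrightarrow> l) G"
    using convergent_filter[of f, OF range] by blast
  from G(3) have "\<exists>m. \<forall>A. ((\<lambda>n. f n A) \<longlongrightarrow> m A) G"
    by (intro choice allI)
  then obtain m where m: "\<And>A. ((\<lambda>n. f n A) \<longlongrightarrow> m A) G" by blast
  have "subinvariant_mean m T"
  proof
    show "0 \<le> m A" for A
      using tendsto_lowerbound[OF m _ G(1), of 0 A] by (simp add: f_def)
    show "m (A \<union> B) = m A + m B" if "A \<inter> B = {}" for A B
    proof -
      have "f n (A \<union> B) = f n A + f n B" for n
      proof -
        have "{b \<in> F n. \<phi> b \<in> A \<union> B} = {b \<in> F n. \<phi> b \<in> A} \<union> {b \<in> F n. \<phi> b \<in> B}" by auto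
        then have "card {b \<in> F n. \<phi> b \<in> A \<union> B} = card {b \<in> F n. \<phi> b \<in> A} + card {b \<in> F n. \<phi> b \<in> B}"
          using that fin[of n] by (subst card_Un_disjoint[symmetric]) auto
        then show ?thesis by (simp add: f_def add_divide_distrib)
      qed
      with tendsto_add[OF m[of A] m[of B]] have "((\<lambda>n. f n (A \<union> B)) \<longlongrightarrow> m A + m B) G"
        by simp
      with G(1) m show ?thesis by (rule tendsto_unique)
    qed
    show "m UNIV = 1"
    proof -
      have "f n UNIV = 1" for n using pos[of n] by (simp add: f_def)
      then have "((\<lambda>n. f n UNIV) \<longlongrightarrow> 1) G" by simp
      with G(1) m show ?thesis by (rule tendsto_unique)
    qed
    show "m A \<le> m (T -` A)" for A
    proof (rule tendsto_le[OF G(1) _ m])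
      show "((\<lambda>n. f n (T -` A) + e n) \<longlongrightarrow> m (T -` A)) G"
        using tendsto_add[OF m[of "T -` A"] tendsto_mono[OF G(2) e]] by simp
      have "f n A \<le> f n (T -` A) + e n" for n
        using almost[of n A] pos[of n] by (simp add: f_def field_simps)
      then show "\<forall>\<^sub>F n in G. f n A \<le> f n (T -` A) + e n" by simp
    qed
  qed
  moreover have "d \<le> m K"
  proof (rule tendsto_lowerbound[OF m _ G(1)])
    have "d \<le> f n K" for n using dense[of n] pos[of n] by (simp add: f_def field_simps)
    then show "\<forall>\<^sub>F n in G. d \<le> f n K" by (intro always_eventually allI)
  qed
  ultimately show thesis by (rule that)
qed

text \<open>A face of a box is smaller than the box by a factor, the length of the side orthogonal to it. This
  controls the boundary of a box under the diagonal shift.\<close>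
lemma card_PiE_face:
  assumes "finite I" "i \<in> I" "\<And>j. j \<in> I \<Longrightarrow> finite (W j)"
  shows "card {a \<in> PiE I W. a i = s} * card (W i) \<le> card (PiE I W)"
proof -
  have "{a \<in> PiE I W. a i = s} \<subseteq> PiE I (W(i := {s}))"
  proof
    fix a assume "a \<in> {a \<in> PiE I W. a i = s}"
    then have "a \<in> PiE I W" "a i = s" by simp_all
    then show "a \<in> PiE I (W(i := {s}))" unfolding PiE_iff by simp
  qed
  moreover have "finite (PiE I (W(i := {s})))"
    using assms by (intro finite_PiE) simp_all
  ultimately have "card {a \<in> PiE I W. a i = s} \<le> card (PiE I (W(i := {s})))"
    by (intro card_mono)
  also have "\<dots> = (\<Prod>j\<in>I - {i}. card (W j))"
    using assms by (simp add: card_PiE prod.remove[of I i] cong: prod.cong_simp)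
  finally show ?thesis
    using assms by (simp add: card_PiE prod.remove[of I i] mult.commute)
qed

text \<open>Independence is built in by letting the return times of the coordinates vary separately: a box of times
  meets the product of the return sets in the product of the proportions. The window lengths may differ
  from coordinate to coordinate, as long as all of them tend to infinity.\<close>
lemma product_mean:
  assumes returns: "\<And>i. i \<in> {1..N} \<Longrightarrow> upper_Banach_dens (return_set (T i) (x i) (K i)) > 0"
  obtains m where "subinvariant_mean m (product_self_map N T)" "m (PiE {1..N} K) > 0"
proof -
  let ?I = "{1..N}"
  define R where "R i = return_set (T i) (x i) (K i)" for i
  have "\<exists>d>0. \<forall>n. \<exists>s L. n \<le> L \<and> d * real L \<le> real (card (R i \<inter> {s..<s + L}))" if "i \<in> ?I" for i
    using dense_windows[OF returns[OF that]] unfolding R_def by metis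
  then obtain d where d: "\<And>i. i \<in> ?I \<Longrightarrow> d i > 0"
    "\<And>i n. i \<in> ?I \<Longrightarrow> \<exists>s L. n \<le> L \<and> d i * real L \<le> real (card (R i \<inter> {s..<s + L}))"
    by metis
  have "\<exists>s L. \<forall>i\<in>?I. Suc n \<le> L i \<and> d i * real (L i) \<le> real (card (R i \<inter> {s i..<s i + L i}))" for n
    using d(2)[of _ "Suc n"] by metis
  then obtain s L where sL: "\<And>n i. i \<in> ?I \<Longrightarrow> Suc n \<le> L n i"
    "\<And>n i. i \<in> ?I \<Longrightarrow> d i * real (L n i) \<le> real (card (R i \<inter> {s n i..<s n i + L n i}))"
    by metis
  define W where "W n i = {s n i..<s n i + L n i}" for n i
  define F where "F n = PiE ?I (W n)" for n
  define \<phi> where "\<phi> a = (\<lambda>i\<in>?I. (T i ^^ a i) (x i))" for a :: "nat \<Rightarrow> nat"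
  define step where "step a = (\<lambda>i\<in>?I. Suc (a i))" for a :: "nat \<Rightarrow> nat"
  have T_\<phi>: "product_self_map N T (\<phi> a) = \<phi> (step a)" for a
    by (auto simp: product_self_map_def \<phi>_def step_def)
  have fin: "finite (F n)" for n
    unfolding F_def by (intro finite_PiE) (auto simp: W_def)
  have L_pos: "0 < L n i" if "i \<in> ?I" for n i using sL(1)[OF that, of n] by simp
  have "\<And>n. F n \<noteq> {}"
    unfolding F_def using L_pos by (auto simp: PiE_eq_empty_iff W_def)
  moreover have "real (card {b \<in> F n. \<phi> b \<in> A})
      \<le> real (card {b \<in> F n. product_self_map N T (\<phi> b) \<in> A}) + real N / real (Suc n) * real (card (F n))"
    for n A
  proof -
    have "{b \<in> F n. \<phi> b \<in> A}
        \<subseteq> step ` {b \<in> F n. \<phi> (step b) \<in> A} \<union> (\<Union>i\<in>?I. {b \<in> F n. b i = s n i})"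
    proof
      fix b assume "b \<in> {b \<in> F n. \<phi> b \<in> A}"
      then have b: "b \<in> F n" "\<phi> b \<in> A" by auto
      show "b \<in> step ` {b \<in> F n. \<phi> (step b) \<in> A} \<union> (\<Union>i\<in>?I. {b \<in> F n. b i = s n i})"
      proof (cases "\<exists>i\<in>?I. b i = s n i")
        case False
        \<comment> \<open>Off the faces \<open>b i = s n i\<close> the predecessor of \<open>b\<close> along the diagonal is still in the box.\<close>
        define a where "a = (\<lambda>i\<in>?I. b i - 1)"
        have b_gt: "s n i < b i \<and> b i < s n i + L n i" if "i \<in> ?I" for i
          using b(1) False that by (force simp: F_def W_def PiE_iff)
        then have "a \<in> F n"
          by (fastforce simp: F_def a_def W_def)
        moreover have "step a = b"
        proof
          fix i show "step a i = b i"
            using b_gt[of i] b(1)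
            by (cases "i \<in> ?I") (auto simp: step_def a_def F_def PiE_iff extensional_def)
        qed
        ultimately show ?thesis using b(2) by blast
      qed (use b(1) in blast)
    qed
    then have "card {b \<in> F n. \<phi> b \<in> A}
        \<le> card (step ` {b \<in> F n. \<phi> (step b) \<in> A} \<union> (\<Union>i\<in>?I. {b \<in> F n. b i = s n i}))"
      using fin by (intro card_mono) auto
    also have "\<dots> \<le> card (step ` {b \<in> F n. \<phi> (step b) \<in> A}) + card (\<Union>i\<in>?I. {b \<in> F n. b i = s n i})"
      by (rule card_Un_le)
    also have "\<dots> \<le> card {b \<in> F n. \<phi> (step b) \<in> A} + (\<Sum>i\<in>?I. card {b \<in> F n. b i = s n i})"
      using fin by (intro add_mono card_image_le card_UN_le) auto
    finally have "real (card {b \<in> F n. \<phi> b \<in> A})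
        \<le> real (card {b \<in> F n. \<phi> (step b) \<in> A}) + (\<Sum>i\<in>?I. real (card {b \<in> F n. b i = s n i}))"
      by (simp flip: of_nat_sum of_nat_add)
    also have "(\<Sum>i\<in>?I. real (card {b \<in> F n. b i = s n i})) \<le> (\<Sum>i\<in>?I. real (card (F n)) / real (Suc n))"
    proof (rule sum_mono)
      fix i assume i: "i \<in> ?I"
      have "card {b \<in> F n. b i = s n i} * Suc n \<le> card {b \<in> F n. b i = s n i} * card (W n i)"
        using sL(1)[OF i, of n] by (intro mult_left_mono) (auto simp: W_def)
      also have "\<dots> \<le> card (F n)"
        unfolding F_def using i by (intro card_PiE_face) (auto simp: W_def)
      finally have "real (card {b \<in> F n. b i = s n i}) * real (Suc n) \<le> real (card (F n))"
        by (simp only: of_nat_le_iff flip: of_nat_mult)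
      then show "real (card {b \<in> F n. b i = s n i}) \<le> real (card (F n)) / real (Suc n)"
        by (simp add: pos_le_divide_eq)
    qed
    finally show ?thesis by (simp add: T_\<phi>)
  qed
  moreover have "(\<lambda>n. real N / real (Suc n)) \<longlonglongrightarrow> 0"
    using tendsto_mult_right_zero[OF LIMSEQ_inverse_real_of_nat, of "real N"]
    by (simp add: divide_inverse)
  moreover have "(\<Prod>i\<in>?I. d i) * real (card (F n)) \<le> real (card {b \<in> F n. \<phi> b \<in> PiE ?I K})" for n
  proof -
    have "{b \<in> F n. \<phi> b \<in> PiE ?I K} = PiE ?I (\<lambda>i. R i \<inter> W n i)"
    proof (rule set_eqI)
      fix b
      have "\<phi> b \<in> PiE ?I K \<longleftrightarrow> (\<forall>i\<in>?I. (T i ^^ b i) (x i) \<in> K i)"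
        by (simp add: \<phi>_def PiE_iff)
      then show "b \<in> {b \<in> F n. \<phi> b \<in> PiE ?I K} \<longleftrightarrow> b \<in> PiE ?I (\<lambda>i. R i \<inter> W n i)"
        unfolding F_def R_def return_set_def mem_Collect_eq PiE_iff Int_iff by blast
    qed
    then have "real (card {b \<in> F n. \<phi> b \<in> PiE ?I K}) = (\<Prod>i\<in>?I. real (card (R i \<inter> W n i)))"
      by (simp add: card_PiE)
    moreover have "(\<Prod>i\<in>?I. d i) * real (card (F n)) = (\<Prod>i\<in>?I. d i * real (L n i))"
      by (simp add: F_def card_PiE W_def prod.distrib)
    moreover have "\<dots> \<le> (\<Prod>i\<in>?I. real (card (R i \<inter> W n i)))"
      using d(1) sL(2) by (intro prod_mono) (auto simp: W_def less_imp_le)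
    ultimately show ?thesis by simp
  qed
  ultimately obtain m where "subinvariant_mean m (product_self_map N T)" "(\<Prod>i\<in>?I. d i) \<le> m (PiE ?I K)"
    using mean_of_almost_invariant_averages[of F \<phi> "product_self_map N T" "\<lambda>n. real N / real (Suc n)"
        "\<Prod>i\<in>?I. d i" "PiE ?I K"] fin by blast
  moreover have "(\<Prod>i\<in>?I. d i) > 0" by (intro prod_pos ballI d(1))
  ultimately show thesis using that[of m] by linarith
qed

section \<open>Countable networks of compact sets\<close>

lemma Polish_imp_second_countable:
  assumes "Polish_topology X"
  shows "second_countable X"
proof -
  obtain M d where "Metric_space M d" and X: "X = Metric_space.mtopology M d"
    using assms unfolding Polish_topology_def completely_metrizable_space_def by blast
  then interpret Metric_space M d by simp
  obtain C where C: "countable C" "C \<subseteq> M" "mtopology closure_of C = M"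
    using assms unfolding Polish_topology_def separable_space_def X by auto
  define \<B> where "\<B> = (\<lambda>(c, n). mball c (1 / real (Suc n))) ` (C \<times> (UNIV :: nat set))"
  show ?thesis
    unfolding second_countable_def X
  proof (intro exI[of _ \<B>] conjI allI impI ballI)
    show "countable \<B>" using C(1) by (simp add: \<B>_def)
    show "openin mtopology V" if "V \<in> \<B>" for V using that by (auto simp: \<B>_def)
    fix U x assume U: "openin mtopology U \<and> x \<in> U"
    then obtain r where r: "r > 0" "mball x r \<subseteq> U" unfolding openin_mtopology by blast
    have xM: "x \<in> M" using U unfolding openin_mtopology by blast
    obtain n where n: "inverse (real (Suc n)) < r / 2"
      using reals_Archimedean[of "r / 2"] r(1) by auto
    have "\<forall>r>0. \<exists>y\<in>C. y \<in> mball x r"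
      using C(3) xM unfolding metric_closure_of by blast
    then have "\<exists>y\<in>C. y \<in> mball x (1 / real (Suc n))" by (simp del: in_mball of_nat_Suc)
    then obtain c where c: "c \<in> C" "c \<in> mball x (1 / real (Suc n))" by blast
    have "x \<in> mball c (1 / real (Suc n))" using c(2) by (auto simp: commute)
    moreover have "mball c (1 / real (Suc n)) \<subseteq> mball x r"
    proof
      fix z assume z: "z \<in> mball c (1 / real (Suc n))"
      have "d x z \<le> d x c + d c z" using c z by (intro triangle) auto
      also have "\<dots> < r" using c z n by (auto simp: inverse_eq_divide)
      finally show "z \<in> mball x r" using z xM by simp
    qed
    ultimately show "\<exists>V\<in>\<B>. x \<in> V \<and> V \<subseteq> U"
      using c(1) r(2) unfolding \<B>_def by blast
  qed
qed

text \<open>Between members \<open>A \<subseteq> B\<close> of a countable base choose one compact set whenever there is one; countably many choices suffice.\<close>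
lemma countable_compact_network:
  assumes "second_countable X" "neighbourhood_base_of (compactin Y) X"
  shows "\<exists>\<K>. countable \<K> \<and> (\<forall>K\<in>\<K>. compactin Y K)
           \<and> (\<forall>U x. openin X U \<and> x \<in> U \<longrightarrow> (\<exists>K\<in>\<K>. x \<in> K \<and> K \<subseteq> U))"
proof -
  obtain \<B> where *: "countable \<B> \<and> (\<forall>V\<in>\<B>. openin X V)
      \<and> (\<forall>U x. openin X U \<and> x \<in> U \<longrightarrow> (\<exists>V\<in>\<B>. x \<in> V \<and> V \<subseteq> U))"
    using assms(1) unfolding second_countable_def ..
  then have \<B>: "countable \<B>" "\<And>V. V \<in> \<B> \<Longrightarrow> openin X V"
    by simp_all
  have refine: "\<exists>V\<in>\<B>. x \<in> V \<and> V \<subseteq> U" if "openin X U" "x \<in> U" for U x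
    using * that by simp
  define P where "P = (\<lambda>(A, B) K. compactin Y K \<and> A \<subseteq> K \<and> K \<subseteq> B)"
  define \<K> where "\<K> = (\<lambda>p. SOME K. P p K) ` {p \<in> \<B> \<times> \<B>. \<exists>K. P p K}"
  have some: "P p (SOME K. P p K)" if "\<exists>K. P p K" for p using someI_ex[OF that] .
  show ?thesis
  proof (intro exI[of _ \<K>] conjI ballI allI impI)
    show "countable \<K>" unfolding \<K>_def using \<B>(1) by (intro countable_image countable_Collect countable_SIGMA)
    show "compactin Y K" if "K \<in> \<K>" for K
    proof -
      obtain p where p: "K = (SOME K. P p K)" "p \<in> {p \<in> \<B> \<times> \<B>. \<exists>K. P p K}"
        using \<open>K \<in> \<K>\<close> unfolding \<K>_def by (rule imageE)
      from p(2) have "\<exists>K. P p K" by simp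
      from some[OF this] show ?thesis unfolding p(1) by (simp add: P_def split_beta)
    qed
    fix U x assume U: "openin X U \<and> x \<in> U"
    then obtain B where B: "B \<in> \<B>" "x \<in> B" "B \<subseteq> U" using refine[of U x] by blast
    have "openin X B" using B(1) by (rule \<B>(2))
    with B(2) have "\<exists>V L. openin X V \<and> compactin Y L \<and> x \<in> V \<and> V \<subseteq> L \<and> L \<subseteq> B"
      using assms(2) unfolding neighbourhood_base_of by simp
    then obtain V L where V: "openin X V" "compactin Y L" "x \<in> V" "V \<subseteq> L" "L \<subseteq> B"
      by blast
    obtain A where A: "A \<in> \<B>" "x \<in> A" "A \<subseteq> V" using refine[OF V(1,3)] by blast
    have "P (A, B) L" using V A by (auto simp: P_def)
    then have ex: "\<exists>K. P (A, B) K" ..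
    define K where "K = (SOME K. P (A, B) K)"
    have "K \<in> \<K>" unfolding K_def \<K>_def using A(1) B(1) ex by blast
    moreover have "A \<subseteq> K" "K \<subseteq> B" using some[OF ex] by (simp_all add: P_def K_def)
    ultimately show "\<exists>K\<in>\<K>. x \<in> K \<and> K \<subseteq> U" using A(2) B(3) by blast
  qed
qed

lemma product_compact_network:
  assumes "finite I"
    and \<K>: "\<And>i. i \<in> I \<Longrightarrow> countable (\<K> i)"
      "\<And>i K. i \<in> I \<Longrightarrow> K \<in> \<K> i \<Longrightarrow> compactin (Y i) K"
      "\<And>i U x. i \<in> I \<Longrightarrow> openin (X i) U \<Longrightarrow> x \<in> U \<Longrightarrow> \<exists>K\<in>\<K> i. x \<in> K \<and> K \<subseteq> U"
  obtains Q :: "nat \<Rightarrow> ('i \<Rightarrow> 'a) set"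
  where "\<And>k. compactin (product_topology Y I) (Q k)"
    and "\<And>U x. openin (product_topology X I) U \<Longrightarrow> x \<in> U \<Longrightarrow> \<exists>k. x \<in> Q k \<and> Q k \<subseteq> U"
proof -
  \<comment> \<open>The empty set ensures that \<open>\<Q>\<close> can be enumerated by the natural numbers, even if some \<open>\<K> i\<close> is empty.\<close>
  define \<Q> where "\<Q> = insert {} (PiE I ` PiE I \<K>)"
  have "countable \<Q>"
    unfolding \<Q>_def using assms by (intro countable_insert countable_image countable_PiE)
  then have range: "range (from_nat_into \<Q>) = \<Q>"
    by (intro range_from_nat_into) (simp add: \<Q>_def)
  show thesis
  proof (rule that)
    fix k
    have "from_nat_into \<Q> k \<in> \<Q>" using range by blast
    then show "compactin (product_topology Y I) (from_nat_into \<Q> k)"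
      unfolding \<Q>_def using \<K>(2) by (auto simp: compactin_PiE PiE_iff)
  next
    fix U x assume "openin (product_topology X I) U" "x \<in> U"
    then have "\<exists>V. (\<forall>i\<in>I. openin (X i) (V i)) \<and> x \<in> PiE I V \<and> PiE I V \<subseteq> U"
      unfolding openin_product_topology_alt by blast
    then obtain V where V: "\<And>i. i \<in> I \<Longrightarrow> openin (X i) (V i)" "x \<in> PiE I V" "PiE I V \<subseteq> U"
      by blast
    have "\<exists>K\<in>\<K> i. x i \<in> K \<and> K \<subseteq> V i" if "i \<in> I" for i
      using V(2) that by (intro \<K>(3) V(1)) auto
    then obtain K where K: "\<And>i. i \<in> I \<Longrightarrow> K i \<in> \<K> i \<and> x i \<in> K i \<and> K i \<subseteq> V i"
      by metis
    have "PiE I K = PiE I (restrict K I)" by (rule PiE_cong) simp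
    moreover have "restrict K I \<in> PiE I \<K>" using K by auto
    ultimately have "PiE I K \<in> \<Q>" unfolding \<Q>_def by blast
    then obtain k where "from_nat_into \<Q> k = PiE I K" using range by (metis imageE)
    moreover have "x \<in> PiE I K" using K V(2) by (auto simp: PiE_iff)
    moreover have "PiE I K \<subseteq> U" using K V(3) PiE_mono[of I K V] by blast
    ultimately show "\<exists>k. x \<in> from_nat_into \<Q> k \<and> from_nat_into \<Q> k \<subseteq> U" by blast
  qed
qed

section \<open>Recurrence in finite products\<close>

lemma product_self_map_funpow:
  "i \<in> {1..N} \<Longrightarrow> (product_self_map N T ^^ n) x i = (T i ^^ n) (x i)"
  by (induction n) (simp_all add: product_self_map_def)

lemma continuous_map_product_self_map:
  assumes "\<And>i. i \<in> {1..N} \<Longrightarrow> continuous_map (X i) (X i) (T i)"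
  shows "continuous_map (product_topology X {1..N}) (product_topology X {1..N}) (product_self_map N T)"
  unfolding continuous_map_componentwise
proof (intro conjI ballI)
  show "product_self_map N T ` topspace (product_topology X {1..N}) \<subseteq> extensional {1..N}"
    by (auto simp: product_self_map_def)
  fix i assume i: "i \<in> {1..N}"
  have "continuous_map (product_topology X {1..N}) (X i) (T i \<circ> (\<lambda>x. x i))"
    using i by (intro continuous_map_compose[OF continuous_map_product_coordinates] assms)
  moreover have "(\<lambda>x. product_self_map N T x i) = T i \<circ> (\<lambda>x. x i)"
    using i by (auto simp: product_self_map_def)
  ultimately show "continuous_map (product_topology X {1..N}) (X i) (\<lambda>x. product_self_map N T x i)"
    by (simp only:)
qed

lemma FRec_subset_UFRec: "FRec X S \<subseteq> UFRec X S"
  unfolding FRec_def UFRec_def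
  using lower_dens_le_upper_dens by (blast intro: order.strict_trans2)

lemma UFRec_subset_RRec: "UFRec X S \<subseteq> RRec X S"
  unfolding RRec_def UFRec_def
  using upper_dens_le_upper_Banach_dens by (blast intro: order.strict_trans2)

text \<open>The returns of \<open>x\<close> to the cylinder over \<open>U\<close> are exactly the returns of \<open>x i\<close> to \<open>U\<close>, since orbits
  stay in the product.\<close>
lemma RRec_product_subset:
  assumes cont: "\<And>i. i \<in> {1..N} \<Longrightarrow> continuous_map (X i) (X i) (T i)"
  shows "RRec (product_topology X {1..N}) (product_self_map N T)
           \<subseteq> (\<Pi>\<^sub>E i\<in>{1..N}. RRec (X i) (T i))"
proof
  let ?X = "product_topology X {1..N}" and ?S = "product_self_map N T"
  fix x assume x: "x \<in> RRec ?X ?S"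
  then have x_top: "x \<in> topspace ?X"
    and RRec_x: "\<And>U. neighbourhood_of_in ?X x U \<Longrightarrow> upper_Banach_dens (return_set ?S x U) > 0"
    unfolding RRec_def by blast+
  have "continuous_map ?X ?X ?S" using cont by (rule continuous_map_product_self_map)
  then have orbit: "(?S ^^ n) x \<in> topspace ?X" for n
    using continuous_map_funspace[OF continuous_map_funpow] x_top by blast
  have "x i \<in> RRec (X i) (T i)" if i: "i \<in> {1..N}" for i
  proof -
    have "upper_Banach_dens (return_set (T i) (x i) U) > 0" if U: "neighbourhood_of_in (X i) (x i) U" for U
    proof -
      obtain V where V: "openin (X i) V" "x i \<in> V" "V \<subseteq> U"
        using U unfolding neighbourhood_of_in_def by blast
      have "openin ?X {y \<in> topspace ?X. y i \<in> V}"
        by (rule openin_continuous_map_preimage[OF continuous_map_product_coordinates[OF i, of X] V(1)])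
      then have nbhd: "neighbourhood_of_in ?X x {y \<in> topspace ?X. y i \<in> U}"
        unfolding neighbourhood_of_in_def using V x_top
        by (intro conjI exI[of _ "{y \<in> topspace ?X. y i \<in> V}"] Collect_restrict) blast+
      have "return_set ?S x {y \<in> topspace ?X. y i \<in> U} = return_set (T i) (x i) U"
        unfolding return_set_def mem_Collect_eq product_self_map_funpow[OF i] using orbit by blast
      with RRec_x[OF nbhd] show ?thesis by (simp only:)
    qed
    moreover have "x i \<in> topspace (X i)" using x_top i by auto
    ultimately show ?thesis by (simp add: RRec_def)
  qed
  then show "x \<in> (\<Pi>\<^sub>E i\<in>{1..N}. RRec (X i) (T i))"
    using x_top by (simp add: PiE_iff)
qed

lemma PiE_RRec_subset_closure_FRec:
  assumes Polish: "\<And>i. i \<in> {1..N} \<Longrightarrow> Polish_topology (X i)"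
    and top: "\<And>i. i \<in> {1..N} \<Longrightarrow> topspace (Y i) = topspace (X i)"
    and Hausdorff: "\<And>i. i \<in> {1..N} \<Longrightarrow> Hausdorff_space (Y i)"
    and cont: "\<And>i. i \<in> {1..N} \<Longrightarrow> continuous_map (Y i) (Y i) (T i)"
    and base: "\<And>i. i \<in> {1..N} \<Longrightarrow> neighbourhood_base_of (compactin (Y i)) (X i)"
  shows "(\<Pi>\<^sub>E i\<in>{1..N}. RRec (X i) (T i))
           \<subseteq> product_topology X {1..N} closure_of FRec (product_topology X {1..N}) (product_self_map N T)"
proof
  let ?I = "{1..N}"
  let ?X = "product_topology X ?I" and ?Y = "product_topology Y ?I" and ?S = "product_self_map N T"
  fix x assume x: "x \<in> (\<Pi>\<^sub>E i\<in>?I. RRec (X i) (T i))"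
  have "\<forall>i\<in>?I. \<exists>\<K>. countable \<K> \<and> (\<forall>K\<in>\<K>. compactin (Y i) K)
           \<and> (\<forall>U x. openin (X i) U \<and> x \<in> U \<longrightarrow> (\<exists>K\<in>\<K>. x \<in> K \<and> K \<subseteq> U))"
    by (intro ballI countable_compact_network Polish_imp_second_countable Polish base)
  from bchoice[OF this] obtain \<K> where \<K>: "\<forall>i\<in>?I. countable (\<K> i) \<and> (\<forall>K\<in>\<K> i. compactin (Y i) K)
           \<and> (\<forall>U x. openin (X i) U \<and> x \<in> U \<longrightarrow> (\<exists>K\<in>\<K> i. x \<in> K \<and> K \<subseteq> U))"
    by blast
  obtain Q :: "nat \<Rightarrow> (nat \<Rightarrow> 'a) set" where Q: "\<And>k. compactin ?Y (Q k)"
      "\<And>U x. openin ?X U \<Longrightarrow> x \<in> U \<Longrightarrow> \<exists>k. x \<in> Q k \<and> Q k \<subseteq> U"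
    by (rule product_compact_network[of ?I \<K> Y X]) (use \<K> in auto)
  have Y_Hausdorff: "Hausdorff_space ?Y"
    using Hausdorff by (auto simp: Hausdorff_space_product_topology)
  have top_eq: "topspace ?X = topspace ?Y"
    using top by (auto simp: PiE_iff)
  have "x \<in> topspace ?X" using x by (auto simp: PiE_iff RRec_def)
  moreover have "\<exists>y\<in>FRec ?X ?S. y \<in> U" if "x \<in> U" "openin ?X U" for U
  proof -
    have "\<exists>V. (\<forall>i\<in>?I. openin (X i) (V i)) \<and> x \<in> PiE ?I V \<and> PiE ?I V \<subseteq> U"
      using that unfolding openin_product_topology_alt by blast
    then obtain V where V: "\<And>i. i \<in> ?I \<Longrightarrow> openin (X i) (V i)" "x \<in> PiE ?I V" "PiE ?I V \<subseteq> U"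
      by blast
    have "\<forall>i\<in>?I. \<exists>K. compactin (Y i) K \<and> neighbourhood_of_in (X i) (x i) K \<and> K \<subseteq> V i"
    proof
      fix i assume i: "i \<in> ?I"
      then have "x i \<in> V i" using V(2) by auto
      then have "\<exists>W K. openin (X i) W \<and> compactin (Y i) K \<and> x i \<in> W \<and> W \<subseteq> K \<and> K \<subseteq> V i"
        using base[OF i] V(1)[OF i] unfolding neighbourhood_base_of by simp
      then obtain W K where W: "openin (X i) W" "compactin (Y i) K" "x i \<in> W" "W \<subseteq> K" "K \<subseteq> V i"
        by blast
      moreover have "K \<subseteq> topspace (X i)" using W(5) openin_subset[OF V(1)[OF i]] by blast
      ultimately show "\<exists>K. compactin (Y i) K \<and> neighbourhood_of_in (X i) (x i) K \<and> K \<subseteq> V i"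
        unfolding neighbourhood_of_in_def by blast
    qed
    from bchoice[OF this] obtain K where K: "\<forall>i\<in>?I. compactin (Y i) (K i)
        \<and> neighbourhood_of_in (X i) (x i) (K i) \<and> K i \<subseteq> V i"
      by blast
    have "upper_Banach_dens (return_set (T i) (x i) (K i)) > 0" if "i \<in> ?I" for i
    proof -
      have "x i \<in> RRec (X i) (T i)" using x that by auto
      then show ?thesis using K that unfolding RRec_def by blast
    qed
    then obtain m where m: "subinvariant_mean m ?S" "m (PiE ?I K) > 0"
      by (rule product_mean)
    have "PiE ?I K \<inter> FRec ?X ?S \<noteq> {}"
    proof (rule subinvariant_mean.FRec_meets_compact[OF m(1) Y_Hausdorff _ top_eq Q _ m(2)])
      show "continuous_map ?Y ?Y ?S" using cont by (rule continuous_map_product_self_map)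
      show "compactin ?Y (PiE ?I K)" using K by (simp add: compactin_PiE)
    qed
    moreover have "PiE ?I K \<subseteq> U" using K V(3) PiE_mono[of ?I K V] by blast
    ultimately show ?thesis by blast
  qed
  ultimately show "x \<in> ?X closure_of FRec ?X ?S" unfolding in_closure_of by blast
qed

theorem theorem5p1:
  fixes N :: nat
    and \<tau>X :: "nat \<Rightarrow> 'a topology"
    and \<tau> :: "nat \<Rightarrow> 'a topology"
    and Ts :: "nat \<Rightarrow> 'a \<Rightarrow> 'a"
    and X :: "(nat \<Rightarrow> 'a) topology"
    and T :: "(nat \<Rightarrow> 'a) \<Rightarrow> (nat \<Rightarrow> 'a)"
  assumes N: "N \<ge> 1"
    and nonempty: "\<And>i. i \<in> {1..N} \<Longrightarrow> topspace (\<tau>X i) \<noteq> {}"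
    and Polish: "\<And>i. i \<in> {1..N} \<Longrightarrow> Polish_topology (\<tau>X i)"
    and cont: "\<And>i. i \<in> {1..N} \<Longrightarrow> continuous_map (\<tau>X i) (\<tau>X i) (Ts i)"
    and same_space: "\<And>i. i \<in> {1..N} \<Longrightarrow> topspace (\<tau> i) = topspace (\<tau>X i)"
    and Hausdorff: "\<And>i. i \<in> {1..N} \<Longrightarrow> Hausdorff_space (\<tau> i)"
    and I: "\<And>i. i \<in> {1..N} \<Longrightarrow> continuous_map (\<tau> i) (\<tau> i) (Ts i)"
    and II: "\<And>i U. i \<in> {1..N} \<Longrightarrow> openin (\<tau> i) U \<Longrightarrow> openin (\<tau>X i) U"
    and III: "\<And>i. i \<in> {1..N} \<Longrightarrow> neighbourhood_base_of (compactin (\<tau> i)) (\<tau>X i)"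
    and X_def: "X = product_topology \<tau>X {1..N}"
    and T_def: "T = product_self_map N Ts"
  shows "X closure_of (FRec X T)
           = (\<Pi>\<^sub>E i\<in>{1..N}. \<tau>X i closure_of (RRec (\<tau>X i) (Ts i)))
       \<and> ((FRec X T \<noteq> {} \<longleftrightarrow> UFRec X T \<noteq> {})
          \<and> (UFRec X T \<noteq> {} \<longleftrightarrow> RRec X T \<noteq> {})
          \<and> (RRec X T \<noteq> {} \<longleftrightarrow> (\<forall>i\<in>{1..N}. RRec (\<tau>X i) (Ts i) \<noteq> {})))
       \<and> ((frequently_recurrent X T \<longleftrightarrow> U_frequently_recurrent X T)
          \<and> (U_frequently_recurrent X T \<longleftrightarrow> reiteratively_recurrent X T)
          \<and> (reiteratively_recurrent X T
               \<longleftrightarrow> (\<forall>i\<in>{1..N}. reiteratively_recurrent (\<tau>X i) (Ts i))))"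
proof -
  let ?I = "{1..N}"
  let ?P = "\<Pi>\<^sub>E i\<in>?I. RRec (\<tau>X i) (Ts i)"
  have FU: "FRec X T \<subseteq> UFRec X T" by (rule FRec_subset_UFRec)
  have UR: "UFRec X T \<subseteq> RRec X T" by (rule UFRec_subset_RRec)
  have RP: "RRec X T \<subseteq> ?P"
    unfolding X_def T_def using cont by (rule RRec_product_subset)
  have PF: "?P \<subseteq> X closure_of FRec X T"
    unfolding X_def T_def
    using Polish same_space Hausdorff I III by (rule PiE_RRec_subset_closure_FRec)
  have sandwich: "X closure_of A = X closure_of ?P" if "FRec X T \<subseteq> A" "A \<subseteq> ?P" for A
  proof (rule subset_antisym)
    show "X closure_of A \<subseteq> X closure_of ?P" using that(2) by (rule closure_of_mono)
    have "X closure_of ?P \<subseteq> X closure_of FRec X T"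
      using PF closedin_closure_of by (rule closure_of_minimal)
    also have "\<dots> \<subseteq> X closure_of A" using that(1) by (rule closure_of_mono)
    finally show "X closure_of ?P \<subseteq> X closure_of A" .
  qed
  have F: "X closure_of FRec X T = X closure_of ?P"
    by (rule sandwich) (use FU UR RP in blast)+
  have U: "X closure_of UFRec X T = X closure_of ?P"
    by (rule sandwich) (use FU UR RP in blast)+
  have R: "X closure_of RRec X T = X closure_of ?P"
    by (rule sandwich) (use FU UR RP in blast)+
  have P: "X closure_of ?P = (\<Pi>\<^sub>E i\<in>?I. \<tau>X i closure_of RRec (\<tau>X i) (Ts i))"
    unfolding X_def by (rule closure_of_product_topology)
  have P_empty: "?P \<noteq> {} \<longleftrightarrow> (\<forall>i\<in>?I. RRec (\<tau>X i) (Ts i) \<noteq> {})"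
    by (simp add: PiE_eq_empty_iff)
  have FP_empty: "?P = {}" if "FRec X T = {}"
    using PF that by simp
  have P_dense: "X closure_of ?P = topspace X
      \<longleftrightarrow> (\<forall>i\<in>?I. \<tau>X i closure_of RRec (\<tau>X i) (Ts i) = topspace (\<tau>X i))"
    unfolding P unfolding X_def topspace_product_topology PiE_eq_iff
    using nonempty by blast
  show ?thesis
  proof (intro conjI)
    show "X closure_of (FRec X T) = (\<Pi>\<^sub>E i\<in>{1..N}. \<tau>X i closure_of (RRec (\<tau>X i) (Ts i)))"
      using F P by (rule trans)
    show "FRec X T \<noteq> {} \<longleftrightarrow> UFRec X T \<noteq> {}" "UFRec X T \<noteq> {} \<longleftrightarrow> RRec X T \<noteq> {}"
      "RRec X T \<noteq> {} \<longleftrightarrow> (\<forall>i\<in>{1..N}. RRec (\<tau>X i) (Ts i) \<noteq> {})"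
      using FU UR RP FP_empty unfolding P_empty[symmetric] by blast+
    show "frequently_recurrent X T \<longleftrightarrow> U_frequently_recurrent X T"
      "U_frequently_recurrent X T \<longleftrightarrow> reiteratively_recurrent X T"
      "reiteratively_recurrent X T \<longleftrightarrow> (\<forall>i\<in>{1..N}. reiteratively_recurrent (\<tau>X i) (Ts i))"
      unfolding frequently_recurrent_def U_frequently_recurrent_def reiteratively_recurrent_def
        F U R P_dense by (rule refl)+
  qed
qed

end
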